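(* The explicit formula for the Gaussian Mersenne Lucas numbers $Gm_n$ is given by $$Gm_n=\sum_{j=0}^{\lfloor n/2\rfloor}(-1)^j\frac{n}{n-j}\binom{n-j}{j}3^{n-2j}2^j + i\sum_{j=0}^{\lfloor (n-1)/2\rfloor}(-1)^j\frac{n-1}{n-j-1}\binom{n-j-1}{j}3^{n-2j-1}2^j.$$
   Context: Here $i$ is the imaginary unit. The Gaussian Mersenne Lucas numbers $\{Gm_n\}_{n\ge 0}$ are the complex numbers defined by $Gm_0 = 2+\frac{3i}{2}$, $Gm_1 = 3+2i$, and $Gm_n = 3Gm_{n-1}-2Gm_{n-2}$ for $n\ge 2$.
   Formalization: The formula is stated for n ≥ 2 only: at n = 1 the second sum contains the undefined quotient 0/0, and at n = 0 the first sum contains 0/0 while the second is empty and cannot give the imaginary part 3/2 of Gm_0. *)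

theory Defs
  imports Complex_Main
begin

fun Gm :: "nat \<Rightarrow> complex" where
  "Gm 0 = 2 + 3 * \<i> / 2"
| "Gm (Suc 0) = 3 + 2 * \<i>"
| "Gm (Suc (Suc n)) = 3 * Gm (Suc n) - 2 * Gm n"

end

theory Submission
  imports Defs
begin

text \<open>
  The recurrence has characteristic polynomial \<open>t\<^sup>2 - 3 t + 2 = (t - 2) (t - 1)\<close>, and the initial
  values single out the solution \<open>2 ^ n + 1\<close> for the real part and \<open>2 ^ (n - 1) + 1\<close> for the
  imaginary part (\<open>Gm_binet\<close>). Both are power sums \<open>x ^ m + y ^ m\<close> at the roots \<open>x = 2\<close>, \<open>y = 1\<close>,
  whose elementary symmetric functions are \<open>x + y = 3\<close> and \<open>x y = 2\<close>. Waring's formula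
  (\<open>waring_two_variables\<close>) writes such a power sum as a polynomial in \<open>x + y\<close> and \<open>x y\<close>;
  used once with \<open>m = n\<close> and once with \<open>m = n - 1\<close>, it gives the two sums of the theorem.

  Waring's formula holds because its right-hand side, the Dickson polynomial in \<open>a = x + y\<close> and
  \<open>b = x y\<close>, satisfies the recurrence \<open>D (m + 2) = a D (m + 1) - b D m\<close> of the power sums. This
  reduces to a Pascal-type rule for its coefficients (\<open>lucas_coeff_rec\<close>). That rule fails
  for \<open>m = 0\<close>: there the quotient \<open>m / (m - j)\<close> is \<open>0 / 0\<close>, which has the value 0 instead of the 2
  that \<open>x ^ 0 + y ^ 0\<close> would require. Hence the induction starts from \<open>m = 1\<close> and \<open>m = 2\<close>.
\<close>

definition lucas_coeff :: "nat \<Rightarrow> nat \<Rightarrow> 'a::field_char_0" where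
  "lucas_coeff m j = of_nat m / of_nat (m - j) * of_nat ((m - j) choose j)"

definition dickson_term :: "'a::field_char_0 \<Rightarrow> 'a \<Rightarrow> nat \<Rightarrow> nat \<Rightarrow> 'a" where
  "dickson_term a b m j = (-1) ^ j * lucas_coeff m j * a ^ (m - 2 * j) * b ^ j"

lemma lucas_coeff_eq_0:
  assumes "m < 2 * j"
  shows "lucas_coeff m j = 0"
  using assms by (simp add: lucas_coeff_def binomial_eq_0)

text \<open>
  With \<open>p = m - j\<close>, all three binomial coefficients are rational multiples of \<open>p choose j\<close>, and the
  rule becomes the identity \<open>p (p + j + 2) = (p + j + 1) (p - j) + (p + j) (j + 1)\<close>.
\<close>

lemma lucas_coeff_rec:
  assumes "m \<ge> 1"
  shows "(lucas_coeff (m + 2) (j + 1) :: 'a::field_char_0)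
    = lucas_coeff (m + 1) (j + 1) + lucas_coeff m j"
proof (cases "m < 2 * j")
  case True
  then show ?thesis by (simp add: lucas_coeff_eq_0)
next
  case False
  define p where "p = m - j"
  have m: "m = p + j" and p: "p \<ge> 1" "j \<le> p"
    using False assms by (auto simp: p_def)
  define B :: 'a where "B = of_nat (p choose j)"
  have j0: "(of_nat j + 1 :: 'a) \<noteq> 0" and p0: "(of_nat p + 1 :: 'a) \<noteq> 0" "(of_nat p :: 'a) \<noteq> 0"
    using p of_nat_neq_0[where 'a='a] by (auto simp: add.commute simp flip: of_nat_Suc)
  have "of_nat (Suc j * (Suc p choose Suc j)) = (of_nat (Suc p * (p choose j)) :: 'a)"
    by (simp only: Suc_times_binomial)
  then have up: "of_nat (Suc p choose Suc j) = (of_nat p + 1) / (of_nat j + 1) * B"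
    using j0 by (simp add: B_def field_simps del: binomial_Suc_Suc)
  have "of_nat (Suc p choose Suc j) = B + of_nat (p choose Suc j)"
    by (simp add: B_def)
  then have right: "of_nat (p choose Suc j) = (of_nat p - of_nat j) / (of_nat j + 1) * B"
    unfolding up using j0 by (simp add: field_simps)
  have "lucas_coeff (m + 2) (j + 1) = (of_nat p + of_nat j + 2) / (of_nat j + 1) * B"
  proof -
    have "m + 2 - (j + 1) = Suc p"
      by (simp add: m)
    then have "lucas_coeff (m + 2) (j + 1)
        = (of_nat p + of_nat j + 2) / (of_nat p + 1) * ((of_nat p + 1) / (of_nat j + 1) * B)"
      unfolding lucas_coeff_def by (simp add: m up add_ac del: binomial_Suc_Suc)
    then show ?thesis
      using p0 by simp
  qed
  moreover have "lucas_coeff (m + 1) (j + 1)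
      = (of_nat p + of_nat j + 1) / of_nat p * ((of_nat p - of_nat j) / (of_nat j + 1) * B)"
    by (simp add: lucas_coeff_def m right add_ac)
  moreover have "lucas_coeff m j = (of_nat p + of_nat j) / of_nat p * B"
    by (simp add: lucas_coeff_def m B_def)
  moreover have "(P + J + 2) / (J + 1) * B
      = (P + J + 1) / P * ((P - J) / (J + 1) * B) + (P + J) / P * B"
    if "P \<noteq> 0" "J + 1 \<noteq> 0" for P J :: 'a
    using that by (simp add: divide_simps) (simp add: algebra_simps)
  ultimately show ?thesis
    using p0 j0 by presburger
qed

lemma dickson_term_eq_0:
  assumes "m < 2 * j"
  shows "dickson_term a b m j = 0"
  using assms by (simp add: dickson_term_def lucas_coeff_eq_0)

lemma dickson_term_rec_0:
  fixes a b :: "'a::field_char_0"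
  shows "dickson_term a b (m + 2) 0 = a * dickson_term a b (m + 1) 0"
  using of_nat_neq_0[of m, where 'a='a] of_nat_neq_0[of "Suc m", where 'a='a]
  by (simp add: dickson_term_def lucas_coeff_def del: of_nat_Suc)

lemma dickson_term_rec_Suc:
  fixes a b :: "'a::field_char_0"
  assumes "m \<ge> 1"
  shows "dickson_term a b (m + 2) (j + 1)
    = a * dickson_term a b (m + 1) (j + 1) - b * dickson_term a b m j"
proof (cases "m < 2 * j + 1")
  case True
  \<comment> \<open>The truncated exponent of \<open>a\<close> in the middle term is wrong here, but its coefficient is 0.\<close>
  then have "lucas_coeff (m + 1) (j + 1) = (0 :: 'a)"
    by (simp add: lucas_coeff_eq_0)
  then show ?thesis
    using lucas_coeff_rec[OF assms, of j, where 'a='a] by (simp add: dickson_term_def)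
next
  case False
  then have "m - 2 * j = Suc (m + 1 - 2 * (j + 1))"
    by simp
  then have "a ^ (m - 2 * j) = a * a ^ (m + 1 - 2 * (j + 1))"
    by (simp only: power_Suc)
  then show ?thesis
    using lucas_coeff_rec[OF assms, of j, where 'a='a]
    by (simp add: dickson_term_def algebra_simps)
qed

text \<open>
  Terms beyond \<open>m div 2\<close> vanish, so the range of summation can be enlarged at will; this lets the
  sums for \<open>m\<close>, \<open>m + 1\<close> and \<open>m + 2\<close> be compared term by term.
\<close>

lemma sum_dickson_term_extend:
  assumes "m div 2 \<le> N"
  shows "(\<Sum>j\<le>N. dickson_term a b m j) = (\<Sum>j = 0..m div 2. dickson_term a b m j)"
  using assms by (intro sum.mono_neutral_right) (auto intro!: dickson_term_eq_0)

lemma sum_dickson_term_rec: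
  assumes "m \<ge> 1"
  shows "(\<Sum>j = 0..(m + 2) div 2. dickson_term a b (m + 2) j)
    = a * (\<Sum>j = 0..(m + 1) div 2. dickson_term a b (m + 1) j)
      - b * (\<Sum>j = 0..m div 2. dickson_term a b m j)"
proof -
  have "(\<Sum>j = 0..(m + 2) div 2. dickson_term a b (m + 2) j)
      = (\<Sum>j\<le>Suc m. dickson_term a b (m + 2) j)"
    by (rule sum_dickson_term_extend[symmetric]) auto
  also have "\<dots> = dickson_term a b (m + 2) 0 + (\<Sum>j\<le>m. dickson_term a b (m + 2) (j + 1))"
    by (subst sum.atMost_Suc_shift) simp
  also have "\<dots> = a * (dickson_term a b (m + 1) 0 + (\<Sum>j\<le>m. dickson_term a b (m + 1) (j + 1)))
      - b * (\<Sum>j\<le>m. dickson_term a b m j)"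
    unfolding dickson_term_rec_0 dickson_term_rec_Suc[OF assms]
    by (simp add: sum_subtractf sum_distrib_left algebra_simps)
  also have "dickson_term a b (m + 1) 0 + (\<Sum>j\<le>m. dickson_term a b (m + 1) (j + 1))
      = (\<Sum>j\<le>Suc m. dickson_term a b (m + 1) j)"
    by (subst sum.atMost_Suc_shift) simp
  also have "\<dots> = (\<Sum>j = 0..(m + 1) div 2. dickson_term a b (m + 1) j)"
    by (rule sum_dickson_term_extend) auto
  also have "(\<Sum>j\<le>m. dickson_term a b m j) = (\<Sum>j = 0..m div 2. dickson_term a b m j)"
    by (rule sum_dickson_term_extend) auto
  finally show ?thesis .
qed

text \<open>
  Both sides satisfy the linear recurrence whose characteristic roots are \<open>x\<close> and \<open>y\<close>, and they
  agree for \<open>m = 1\<close> and \<open>m = 2\<close>.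
\<close>

theorem waring_two_variables:
  fixes x y :: "'a::field_char_0"
  assumes "m \<ge> 1"
  shows "(\<Sum>j = 0..m div 2. dickson_term (x + y) (x * y) m j) = x ^ m + y ^ m"
  using assms
proof (induction m rule: less_induct)
  case (less m)
  consider "m = 1" | "m = 2" | k where "m = k + 2" "k \<ge> 1"
    using less.prems by (metis One_nat_def Suc_eq_plus1 add_2_eq_Suc' not0_implies_Suc
        not_one_le_zero one_add_one le_add2)
  then show ?case
  proof cases
    case 1
    then show ?thesis by (simp add: dickson_term_def lucas_coeff_def)
  next
    case 2
    then show ?thesis
      by (simp add: dickson_term_def lucas_coeff_def power2_eq_square algebra_simps)
  next
    case 3
    then show ?thesis
      using less.IH[of k] less.IH[of "k + 1"] sum_dickson_term_rec[of k "x + y" "x * y"]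
      by (simp add: algebra_simps)
  qed
qed

text \<open>
  The index is shifted because the imaginary part at 0 is \<open>3 / 2 = 2 powi (-1) + 1\<close>, outside the
  reach of natural exponents.
\<close>

lemma Gm_binet: "Gm (Suc n) = (2 ^ Suc n + 1) + \<i> * (2 ^ n + 1)"
proof (induction n rule: less_induct)
  case (less n)
  consider "n = 0" | "n = 1" | k where "n = Suc (Suc k)"
    by (metis One_nat_def not0_implies_Suc)
  then show ?case
  proof cases
    case 3
    then show ?thesis
      using less.IH[of k] less.IH[of "Suc k"]
      by (simp only: Gm.simps) (simp add: algebra_simps)
  qed (simp_all add: algebra_simps)
qed

theorem theorem3:
  fixes n :: nat
  assumes "n \<ge> 2"
  shows "Gm n =
    (\<Sum>j = 0..n div 2.
      (-1) ^ j * (of_nat n / of_nat (n - j)) * of_nat ((n - j) choose j) * 3 ^ (n - 2 * j) * 2 ^ j)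
    + \<i> * (\<Sum>j = 0..(n - 1) div 2.
      (-1) ^ j * (of_nat (n - 1) / of_nat (n - j - 1)) * of_nat ((n - j - 1) choose j)
        * 3 ^ (n - 2 * j - 1) * 2 ^ j)"
proof -
  have waring: "(\<Sum>j = 0..m div 2. (-1) ^ j * (of_nat m / of_nat (m - j))
      * of_nat ((m - j) choose j) * 3 ^ (m - 2 * j) * 2 ^ j) = (2 ^ m + 1 :: complex)"
    if "m \<ge> 1" for m
    using waring_two_variables[OF that, of 2 "1 :: complex"]
    by (simp add: dickson_term_def lucas_coeff_def mult.assoc)
  have shift: "n - j - 1 = n - 1 - j" "n - 2 * j - 1 = n - 1 - 2 * j" for j
    by simp_all
  have "Gm n = (2 ^ n + 1) + \<i> * (2 ^ (n - 1) + 1)"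
    using Gm_binet[of "n - 1"] assms by simp
  then show ?thesis
    unfolding shift using waring[of n] waring[of "n - 1"] assms by simp
qed

end
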